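(* Let $\mathcal I\subseteq\mathbb R$ be an interval, let $(Q_\nu)_{\nu\in\mathcal I}$ be a family of probability measures on $\mathbb N_0$ with common support $S\subseteq\mathbb N_0$, with $q_\nu(n)=Q_\nu(\{n\})>0$ for $n\in S$ and $\nu\mapsto q_\nu(n)$ differentiable on $\mathcal I$ for every $n\in S$. Let $F$ be a fixed probability measure on $\mathbb N=\{1,2,\dots\}$, and let $C_\nu$ be the compound law with counting law $Q_\nu$ and summand law $F$. Suppose that $q_\nu(n)=w_n(\nu)/A(\nu)$, where $w_n(\nu)>0$ for $n\in S$, $w_n$ and $A$ are differentiable on $\mathcal I$, $A(\nu)=\sum_{n\in S}w_n(\nu)$, and $\partial_\nu A(\nu)=\sum_{n\in S}\partial_\nu w_n(\nu)$ (an absolutely convergent sum). Set $\mathcal G_\nu(n)=\partial_\nu\log w_n(\nu)$. Then $$K_\nu(k)=\mathbb E[\mathcal G_\nu(N)\mid X=k]$$ is a kernel of $C_\nu$.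
   Context: $\mathbb N_0=\{0\}\cup\mathbb N$. Convolution powers: $F^{*0}=\delta_0$ (unit mass at $0$) and $F^{*n}=F^{*(n-1)}*F$ for $n\ge1$. Compound law. For a counting law $Q_\nu$ on $\mathbb N_0$ and a summand law $F$ on $\mathbb N$, let $N$ have law $Q_\nu$ and let $(J_i)_{i\ge1}$ be i.i.d. with law $F$, independent of $N$. Set $X=\sum_{i=1}^N J_i$ (with $X=0$ if $N=0$). $C_\nu$ is the law of $X$, with mass function $f_\nu(k)=\sum_{n\in S}q_\nu(n)F^{*n}(\{k\})$. Conditional expectations given $X=k$ are under the joint law of $(N,X)$ at parameter $\nu$. Kernel. The score of $C_\nu$ is $s_\nu(k)=\partial_\nu\log f_\nu(k)$ for $k$ in the common support of the $C_\nu$. A kernel of $C_\nu$ is any $C_\nu$-integrable function $K_\nu$ on this common support with $s_\nu(k)=K_\nu(k)-\sum_j K_\nu(j)f_\nu(j)$ for all $k$ in the common support. *)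

theory Defs
  imports "HOL-Probability.Probability"
begin

(* Derivative relative to I, so one-sided at an endpoint of I that belongs to I.  It is only
   meaningful where f is differentiable within I and I has no isolated points. *)
definition deriv_in :: "real set \<Rightarrow> (real \<Rightarrow> real) \<Rightarrow> real \<Rightarrow> real" where
  "deriv_in I f \<nu> = vector_derivative f (at \<nu> within I)"

definition common_support :: "real set \<Rightarrow> (real \<Rightarrow> nat pmf) \<Rightarrow> nat set \<Rightarrow> bool" where
  "common_support I P S \<longleftrightarrow> (\<forall>\<nu>\<in>I. set_pmf (P \<nu>) = S)"

(* Law of (N, X) with N distributed as Q and X = J_1 + ... + J_N.  Given N = n, only
   J_1, ..., J_n matter; they are sampled as an i.i.d. list, independently of N. *)
definition compound_joint :: "nat pmf \<Rightarrow> nat pmf \<Rightarrow> (nat \<times> nat) pmf" where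
  "compound_joint Q F =
     do {n \<leftarrow> Q; js \<leftarrow> replicate_pmf n F; return_pmf (n, sum_list js)}"

definition compound :: "nat pmf \<Rightarrow> nat pmf \<Rightarrow> nat pmf" where
  "compound Q F = map_pmf snd (compound_joint Q F)"

(* E[g(N) | X = k]; cond_pmf is unspecified if X = k has probability 0. *)
definition cond_exp_given_sum :: "nat pmf \<Rightarrow> nat pmf \<Rightarrow> (nat \<Rightarrow> real) \<Rightarrow> nat \<Rightarrow> real" where
  "cond_exp_given_sum Q F g k =
     measure_pmf.expectation (cond_pmf (compound_joint Q F) {z. snd z = k}) (\<lambda>z. g (fst z))"

definition score :: "real set \<Rightarrow> (real \<Rightarrow> nat pmf) \<Rightarrow> real \<Rightarrow> nat \<Rightarrow> real" where
  "score I C \<nu> k = deriv_in I (\<lambda>\<mu>. ln (pmf (C \<mu>) k)) \<nu>"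

(* The existence of the common support and of the score is part of the notion.  K is a total
   function here, but its values off the common support play no role. *)
definition is_kernel :: "real set \<Rightarrow> (real \<Rightarrow> nat pmf) \<Rightarrow> real \<Rightarrow> (nat \<Rightarrow> real) \<Rightarrow> bool" where
  "is_kernel I C \<nu> K \<longleftrightarrow>
     (\<exists>T. common_support I C T \<and>
        integrable (measure_pmf (C \<nu>)) K \<and>
        (\<forall>k\<in>T. (\<lambda>\<mu>. ln (pmf (C \<mu>) k)) differentiable (at \<nu> within I) \<and>
               score I C \<nu> k = K k - (\<Sum>\<^sub>\<infinity>j\<in>T. K j * pmf (C \<nu>) j)))"

primrec conv_power :: "nat \<Rightarrow> nat pmf \<Rightarrow> nat pmf" where
  "conv_power 0 F = return_pmf 0"
| "conv_power (Suc n) F = map_pmf (\<lambda>(x, y). x + y) (pair_pmf (conv_power n F) F)"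

lemma sum_list_replicate_pmf: "map_pmf sum_list (replicate_pmf n F) = conv_power n F"
proof (induction n)
  case (Suc n)
  have "conv_power (Suc n) F =
          do {xs \<leftarrow> replicate_pmf n F; x \<leftarrow> F; return_pmf (sum_list xs + x)}"
    by (simp add: Suc[symmetric] pair_pmf_def map_pmf_def bind_assoc_pmf bind_return_pmf)
  also have "\<dots> = do {x \<leftarrow> F; xs \<leftarrow> replicate_pmf n F; return_pmf (sum_list xs + x)}"
    by (rule bind_commute_pmf)
  also have "\<dots> = map_pmf sum_list (replicate_pmf (Suc n) F)"
    by (simp add: map_pmf_def bind_assoc_pmf bind_return_pmf add.commute)
  finally show ?case ..
qed simp

lemma pmf_compound:
  "pmf (compound Q F) k = (\<Sum>\<^sub>\<infinity>n\<in>set_pmf Q. pmf Q n * pmf (conv_power n F) k)"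
proof -
  have "compound Q F = bind_pmf Q (\<lambda>n. map_pmf sum_list (replicate_pmf n F))"
    by (simp add: compound_def compound_joint_def map_pmf_def bind_assoc_pmf bind_return_pmf)
  then have "compound Q F = bind_pmf Q (\<lambda>n. conv_power n F)"
    by (simp add: sum_list_replicate_pmf)
  then have "pmf (compound Q F) k = (\<integral>n. pmf (conv_power n F) k \<partial>measure_pmf Q)"
    by (simp add: pmf_bind)
  also have "\<dots> = infsetsum (\<lambda>n. pmf Q n * pmf (conv_power n F) k) UNIV"
    by (simp add: pmf_expectation_eq_infsetsum)
  also have "\<dots> = (\<Sum>\<^sub>\<infinity>n. pmf Q n * pmf (conv_power n F) k)"
  proof (rule infsetsum_infsum)
    show "Infinite_Set_Sum.abs_summable_on (\<lambda>n. pmf Q n * pmf (conv_power n F) k) UNIV"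
      by (rule abs_summable_on_comparison_test'[OF pmf_abs_summable[of Q]])
         (simp add: pmf_le_1 mult_left_le)
  qed
  also have "\<dots> = (\<Sum>\<^sub>\<infinity>n\<in>set_pmf Q. pmf Q n * pmf (conv_power n F) k)"
    by (rule infsum_cong_neutral) (auto simp: set_pmf_iff)
  finally show ?thesis .
qed

end

theory Submission
  imports Defs
begin

text \<open>
  Write \<open>c n k\<close> for \<open>pmf (conv_power n F) k\<close> and \<open>f \<nu> k\<close> for the mass function of the compound
  law, the law of the sum \<open>X\<close> of \<open>N\<close> independent summands, \<open>N\<close> being the counting variable.
  Because the summands are at least \<open>1\<close>, a sum of \<open>n\<close> of them cannot be smaller than \<open>n\<close>, so
  \<open>c n k = 0\<close> for \<open>n > k\<close>. Hence, for fixed \<open>k\<close>, the identity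
  \<open>A \<nu> * f \<nu> k = (\<Sum>n. w n \<nu> * c n k)\<close> involves only finitely many terms and may be differentiated
  term by term. Taking logarithms first separates the normalisation:
  at a point \<open>k\<close> of the support the score is \<open>(\<Sum>n. w' n * c n k) / (\<Sum>n. w n * c n k) - A' / A\<close>.

  The weight of \<open>n\<close> in the law of \<open>N\<close> given \<open>X = k\<close> is proportional to \<open>w n * c n k\<close>, so the first
  fraction is the conditional expectation of \<open>w' n / w n\<close>, the derivative of \<open>ln (w n)\<close>
  (\<open>cond_exp_given_sum_times_pmf\<close>). It remains to see that \<open>A' / A\<close> is the mean of this conditional
  expectation. By the tower property (\<open>integrable_cond_exp_given_sum\<close> and
  \<open>has_sum_cond_exp_given_sum\<close>) that mean is the expectation of \<open>w' n / w n\<close> under the counting law,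
  that is \<open>(\<Sum>n. w' n) / A\<close>, and the series for \<open>A\<close> can be differentiated term by term by
  assumption. The absolute convergence of \<open>\<Sum>n. w' n\<close> is what makes the tower property applicable.
\<close>

section \<open>The compound law with positive summands\<close>

lemma has_sum_pmf: "(pmf p has_sum 1) UNIV"
proof -
  have "Infinite_Set_Sum.abs_summable_on (pmf p) UNIV"
    by (rule pmf_abs_summable)
  moreover from this have "pmf p summable_on UNIV"
    by (simp add: abs_summable_equivalent[symmetric] abs_summable_summable)
  ultimately show ?thesis
    by (simp add: has_sum_infsum infsetsum_infsum[symmetric] infsetsum_pmf_eq_1
        has_sum_iff)
qed

lemma integrable_measure_pmf_iff_summable_on:
  fixes f :: "'a \<Rightarrow> real"
  shows "integrable (measure_pmf p) f \<longleftrightarrow> (\<lambda>x. f x * pmf p x) summable_on UNIV"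
proof -
  have "integrable (measure_pmf p) f \<longleftrightarrow>
          Infinite_Set_Sum.abs_summable_on (\<lambda>x. f x * pmf p x) UNIV"
    by (simp add: measure_pmf_eq_density integrable_density abs_summable_on_def mult.commute)
  then show ?thesis
    unfolding abs_summable_equivalent[symmetric] summable_on_iff_abs_summable_on_real[symmetric] .
qed

lemma compound_joint_eq_bind_conv_power:
  "compound_joint Q F = bind_pmf Q (\<lambda>n. map_pmf (Pair n) (conv_power n F))"
  by (simp add: compound_joint_def sum_list_replicate_pmf[symmetric] map_pmf_def bind_assoc_pmf
      bind_return_pmf)

lemma pmf_compound_joint:
  "pmf (compound_joint Q F) (n, k) = pmf Q n * pmf (conv_power n F) k"
proof -
  have other: "pmf (map_pmf (Pair m) (conv_power m F)) (n, k) = 0" if "m \<noteq> n" for m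
    using that by (auto simp: pmf_eq_0_set_pmf)
  have "pmf (compound_joint Q F) (n, k) =
          (\<integral>m. pmf (map_pmf (Pair m) (conv_power m F)) (n, k) \<partial>measure_pmf Q)"
    by (simp add: compound_joint_eq_bind_conv_power pmf_bind)
  also have "\<dots> = (\<Sum>m\<in>{n}. pmf (map_pmf (Pair m) (conv_power m F)) (n, k) * pmf Q m)"
    by (rule integral_measure_pmf_real) (use other in auto)
  also have "\<dots> = pmf Q n * pmf (conv_power n F) k"
    by (simp add: pmf_map_inj' inj_def)
  finally show ?thesis .
qed

lemma set_pmf_compound: "set_pmf (compound Q F) = (\<Union>n\<in>set_pmf Q. set_pmf (conv_power n F))"
  by (auto simp: compound_def compound_joint_eq_bind_conv_power image_iff)

lemma conv_power_support_ge:
  assumes "0 \<notin> set_pmf F" and "k \<in> set_pmf (conv_power n F)"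
  shows "n \<le> k"
  using assms(2)
proof (induction n arbitrary: k)
  case (Suc n)
  then obtain x y where "x \<in> set_pmf (conv_power n F)" "y \<in> set_pmf F" "k = x + y"
    by auto
  moreover from this have "y \<noteq> 0"
    using assms(1) by metis
  ultimately show ?case
    using Suc.IH[of x] by simp
qed simp

lemma pmf_conv_power_eq_0:
  assumes "0 \<notin> set_pmf F" and "k < n"
  shows "pmf (conv_power n F) k = 0"
  using conv_power_support_ge[OF assms(1), of k n] assms(2) by (auto simp: pmf_eq_0_set_pmf)

lemma infsum_mult_conv_power:
  fixes h :: "nat \<Rightarrow> real"
  assumes "0 \<notin> set_pmf F"
  shows "(\<Sum>\<^sub>\<infinity>n\<in>S. h n * pmf (conv_power n F) k)
           = (\<Sum>n\<in>S \<inter> {..k}. h n * pmf (conv_power n F) k)"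
proof -
  have "(\<Sum>\<^sub>\<infinity>n\<in>S. h n * pmf (conv_power n F) k)
          = (\<Sum>\<^sub>\<infinity>n\<in>S \<inter> {..k}. h n * pmf (conv_power n F) k)"
    by (rule infsum_cong_neutral) (use pmf_conv_power_eq_0[OF assms] in \<open>auto simp: not_le\<close>)
  then show ?thesis
    by simp
qed

section \<open>Conditioning the counting variable on the sum\<close>

lemma prob_sum_eq: "measure_pmf.prob (compound_joint Q F) {z. snd z = k} = pmf (compound Q F) k"
  by (simp add: compound_def pmf_map vimage_def)

text \<open>
  Bayes' formula. Given \<open>X = k\<close>, the counting variable takes values at most \<open>k\<close>, so the
  conditional expectation is a finite sum over the conditional mass function. When \<open>X = k\<close> has
  probability zero, both sides vanish whatever value the conditional expectation is given.
\<close>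
lemma cond_exp_given_sum_times_pmf:
  assumes F: "0 \<notin> set_pmf F"
  shows "cond_exp_given_sum Q F g k * pmf (compound Q F) k
           = (\<Sum>n\<in>set_pmf Q \<inter> {..k}. g n * pmf Q n * pmf (conv_power n F) k)"
proof (cases "pmf (compound Q F) k = 0")
  case True
  have "g n * pmf Q n * pmf (conv_power n F) k = 0" if "n \<in> set_pmf Q" for n
    using True that by (auto simp: pmf_eq_0_set_pmf set_pmf_compound)
  then have "(\<Sum>n\<in>set_pmf Q \<inter> {..k}. g n * pmf Q n * pmf (conv_power n F) k) = 0"
    by (intro sum.neutral) blast
  then show ?thesis
    using True by simp
next
  case False
  let ?J = "compound_joint Q F" and ?E = "{z :: nat \<times> nat. snd z = k}"
  have ne: "set_pmf ?J \<inter> ?E \<noteq> {}"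
    using False by (auto simp: pmf_eq_0_set_pmf compound_def)
  have supp: "z \<in> (\<lambda>n. (n, k)) ` (set_pmf Q \<inter> {..k})" if "z \<in> set_pmf (cond_pmf ?J ?E)" for z
  proof -
    from that have "z \<in> set_pmf ?J" "snd z = k"
      by (auto simp: set_cond_pmf[OF ne])
    then have "fst z \<in> set_pmf Q" "k \<in> set_pmf (conv_power (fst z) F)"
      by (auto simp: compound_joint_eq_bind_conv_power)
    with conv_power_support_ge[OF F] \<open>snd z = k\<close> show ?thesis
      by (cases z) auto
  qed
  have "cond_exp_given_sum Q F g k
          = (\<Sum>z\<in>(\<lambda>n. (n, k)) ` (set_pmf Q \<inter> {..k}). g (fst z) * pmf (cond_pmf ?J ?E) z)"
    unfolding cond_exp_given_sum_def
    by (rule integral_measure_pmf_real) (use supp in auto)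
  also have "\<dots> = (\<Sum>n\<in>set_pmf Q \<inter> {..k}. g n * pmf (cond_pmf ?J ?E) (n, k))"
    by (subst sum.reindex) (auto simp: inj_on_def)
  also have "\<dots> = (\<Sum>n\<in>set_pmf Q \<inter> {..k}. g n * pmf Q n * pmf (conv_power n F) k)
                    / pmf (compound Q F) k"
    by (simp add: pmf_cond[OF ne] pmf_compound_joint prob_sum_eq sum_divide_distrib mult.assoc)
  finally show ?thesis
    using False by simp
qed

text \<open>
  The tower property, as an exchange of the order of summation in the absolutely summable family
  \<open>g n * pmf Q n * pmf (conv_power n F) k\<close>: summing over \<open>k\<close> first returns \<open>g n * pmf Q n\<close>, since a
  convolution power has total mass one; summing over \<open>n\<close> first gives the conditional expectation
  times the mass of \<open>k\<close>, by Bayes' formula.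
\<close>
lemma has_sum_cond_exp_given_sum:
  assumes F: "0 \<notin> set_pmf F" and g: "(\<lambda>n. g n * pmf Q n) summable_on set_pmf Q"
  shows "((\<lambda>k. cond_exp_given_sum Q F g k * pmf (compound Q F) k)
           has_sum (\<Sum>\<^sub>\<infinity>n\<in>set_pmf Q. g n * pmf Q n)) UNIV"
proof -
  let ?h = "\<lambda>n k. g n * pmf Q n * pmf (conv_power n F) k"
  have row: "((\<lambda>k. a * pmf (conv_power n F) k) has_sum a) UNIV" for a n
    using has_sum_cmult_right[OF has_sum_pmf, of a "conv_power n F"] by simp
  have "Infinite_Sum.abs_summable_on (\<lambda>(n, k). ?h n k) (set_pmf Q \<times> UNIV)"
  proof (subst Infinite_Sum.abs_summable_on_Sigma_iff, intro conjI ballI)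
    fix n
    show "Infinite_Sum.abs_summable_on (\<lambda>k. case (n, k) of (n, k) \<Rightarrow> ?h n k) UNIV"
      using has_sum_imp_summable[OF row[of "g n * pmf Q n" n]]
      unfolding prod.case by (subst (asm) summable_on_iff_abs_summable_on_real)
  next
    have "(\<Sum>\<^sub>\<infinity>k. norm (?h n k)) = \<bar>g n * pmf Q n\<bar>" for n
      using infsumI[OF row[of "\<bar>g n * pmf Q n\<bar>" n]] by (simp add: abs_mult)
    then show "Infinite_Sum.abs_summable_on
            (\<lambda>n. \<Sum>\<^sub>\<infinity>k. norm (case (n, k) of (n, k) \<Rightarrow> ?h n k)) (set_pmf Q)"
      using g by (subst (asm) summable_on_iff_abs_summable_on_real) simp
  qed
  then have sum: "(\<lambda>(n, k). ?h n k) summable_on set_pmf Q \<times> UNIV"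
    by (rule abs_summable_summable)
  then have sum': "(\<lambda>(k, n). ?h n k) summable_on UNIV \<times> set_pmf Q"
    using summable_on_reindex[of prod.swap "UNIV \<times> set_pmf Q" "\<lambda>(n, k). ?h n k"]
    by (simp add: product_swap o_def case_prod_unfold)
  have column: "(\<Sum>\<^sub>\<infinity>n\<in>set_pmf Q. ?h n k) = cond_exp_given_sum Q F g k * pmf (compound Q F) k" for k
    by (simp add: cond_exp_given_sum_times_pmf[OF F] infsum_mult_conv_power[OF F])
  have "(\<lambda>k. cond_exp_given_sum Q F g k * pmf (compound Q F) k) summable_on UNIV"
    using summable_on_Sigma_banach[OF sum'] by (simp add: column)
  moreover have "(\<Sum>\<^sub>\<infinity>k. cond_exp_given_sum Q F g k * pmf (compound Q F) k)
                   = (\<Sum>\<^sub>\<infinity>n\<in>set_pmf Q. g n * pmf Q n)"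
    using infsum_swap_banach[OF sum] by (simp add: column infsumI[OF row])
  ultimately show ?thesis
    by (simp add: has_sum_iff)
qed

corollary integrable_cond_exp_given_sum:
  assumes "0 \<notin> set_pmf F" and "(\<lambda>n. g n * pmf Q n) summable_on set_pmf Q"
  shows "integrable (measure_pmf (compound Q F)) (cond_exp_given_sum Q F g)"
  using has_sum_imp_summable[OF has_sum_cond_exp_given_sum[OF assms]]
  by (simp add: integrable_measure_pmf_iff_summable_on)

section \<open>Derivatives relative to an interval\<close>

lemma at_within_interval_neq_bot:
  fixes I :: "real set"
  assumes "is_interval I" and "\<exists>a\<in>I. \<exists>b\<in>I. a < b" and "\<nu> \<in> I"
  shows "at \<nu> within I \<noteq> bot"
  using connected_imp_perfect[of I \<nu>] assms
  by (force simp: trivial_limit_within is_interval_connected)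

lemma deriv_in_eqI:
  assumes "at \<nu> within I \<noteq> bot" and "(f has_real_derivative D) (at \<nu> within I)"
  shows "deriv_in I f \<nu> = D"
  using assms unfolding deriv_in_def
  by (intro vector_derivative_within) (auto simp: has_real_derivative_iff_has_vector_derivative)

lemma has_real_derivative_deriv_in:
  assumes "f differentiable_on I" and "\<nu> \<in> I"
  shows "(f has_real_derivative deriv_in I f \<nu>) (at \<nu> within I)"
  using assms unfolding deriv_in_def differentiable_on_def
  by (simp add: has_real_derivative_iff_has_vector_derivative vector_derivative_works)

lemma has_real_derivative_ln_within:
  assumes "(f has_real_derivative D) (at x within I)" and "f x > 0"
  shows "((\<lambda>y. ln (f y)) has_real_derivative D / f x) (at x within I)"
  by (rule derivative_eq_intros assms refl)+ simp

section \<open>The kernel\<close>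

theorem corollary3p13:
  fixes I :: "real set" and S :: "nat set"
    and Q :: "real \<Rightarrow> nat pmf" and F :: "nat pmf"
    and w :: "nat \<Rightarrow> real \<Rightarrow> real" and A :: "real \<Rightarrow> real"
  assumes "is_interval I" and "\<exists>a\<in>I. \<exists>b\<in>I. a < b"
    and "common_support I Q S"
    and "\<And>n. n \<in> S \<Longrightarrow> (\<lambda>\<nu>. pmf (Q \<nu>) n) differentiable_on I"
    and "0 \<notin> set_pmf F"
    and "\<And>n \<nu>. n \<in> S \<Longrightarrow> \<nu> \<in> I \<Longrightarrow> pmf (Q \<nu>) n = w n \<nu> / A \<nu>"
    and "\<And>n \<nu>. n \<in> S \<Longrightarrow> \<nu> \<in> I \<Longrightarrow> w n \<nu> > 0"
    and "\<And>n. n \<in> S \<Longrightarrow> w n differentiable_on I"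
    and "A differentiable_on I"
    and "\<And>\<nu>. \<nu> \<in> I \<Longrightarrow> ((\<lambda>n. w n \<nu>) has_sum A \<nu>) S"
    and "\<And>\<nu>. \<nu> \<in> I \<Longrightarrow> (\<lambda>n. \<bar>deriv_in I (w n) \<nu>\<bar>) summable_on S"
    and "\<And>\<nu>. \<nu> \<in> I \<Longrightarrow> deriv_in I A \<nu> = (\<Sum>\<^sub>\<infinity>n\<in>S. deriv_in I (w n) \<nu>)"
    and "\<nu> \<in> I"
  shows "is_kernel I (\<lambda>\<mu>. compound (Q \<mu>) F) \<nu>
           (\<lambda>k. cond_exp_given_sum (Q \<nu>) F (\<lambda>n. deriv_in I (\<lambda>\<mu>. ln (w n \<mu>)) \<nu>) k)"
proof -
  let ?G = "\<lambda>n. deriv_in I (\<lambda>\<mu>. ln (w n \<mu>)) \<nu>"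
  let ?K = "cond_exp_given_sum (Q \<nu>) F ?G"
  let ?w' = "\<lambda>n. deriv_in I (w n) \<nu>"
  let ?c = "\<lambda>n k. pmf (conv_power n F) k"
  define T where "T = (\<Union>n\<in>S. set_pmf (conv_power n F))"
  note nontrivial = at_within_interval_neq_bot[OF assms(1,2) assms(13)]
  note w_pos = assms(7)
  have supp: "set_pmf (Q \<mu>) = S" if "\<mu> \<in> I" for \<mu>
    using assms(3) that by (simp add: common_support_def)
  have T: "set_pmf (compound (Q \<mu>) F) = T" if "\<mu> \<in> I" for \<mu>
    by (simp add: set_pmf_compound supp[OF that] T_def)
  have A_pos: "A \<mu> > 0" if "\<mu> \<in> I" for \<mu>
  proof -
    have "S \<noteq> {}"
      using supp[OF that] set_pmf_not_empty[of "Q \<mu>"] by simp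
    then obtain n where "n \<in> S"
      by blast
    then have "pmf (Q \<mu>) n > 0"
      using supp[OF that] by (simp add: pmf_positive)
    then show ?thesis
      using assms(6)[OF \<open>n \<in> S\<close> that] w_pos[OF \<open>n \<in> S\<close> that] by (simp add: zero_less_divide_iff)
  qed
  have dw: "(w n has_real_derivative ?w' n) (at \<nu> within I)" if "n \<in> S" for n
    by (rule has_real_derivative_deriv_in[OF assms(8)[OF that] assms(13)])
  have dA: "(A has_real_derivative deriv_in I A \<nu>) (at \<nu> within I)"
    by (rule has_real_derivative_deriv_in[OF assms(9) assms(13)])
  have G: "?G n * pmf (Q \<nu>) n = ?w' n / A \<nu>" if "n \<in> S" for n
  proof -
    have "?G n = ?w' n / w n \<nu>"
      by (rule deriv_in_eqI[OF nontrivial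
            has_real_derivative_ln_within[OF dw[OF that] w_pos[OF that assms(13)]]])
    then show ?thesis
      using assms(6)[OF that assms(13)] w_pos[OF that assms(13)] by simp
  qed
  have "(\<lambda>n. ?w' n / A \<nu>) summable_on S"
    using assms(11)[OF assms(13)] unfolding divide_inverse
    by (intro summable_on_cmult_left) (subst summable_on_iff_abs_summable_on_real, simp)
  then have G_summable: "(\<lambda>n. ?G n * pmf (Q \<nu>) n) summable_on set_pmf (Q \<nu>)"
    unfolding supp[OF assms(13)] by (subst summable_on_cong[OF G])
  have "(\<Sum>\<^sub>\<infinity>n\<in>S. ?G n * pmf (Q \<nu>) n) = (\<Sum>\<^sub>\<infinity>n\<in>S. ?w' n) / A \<nu>"
    by (simp add: infsum_cong[OF G] divide_inverse infsum_cmult_left')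
  then have mean_G: "(\<Sum>\<^sub>\<infinity>n\<in>S. ?G n * pmf (Q \<nu>) n) = deriv_in I A \<nu> / A \<nu>"
    by (simp add: assms(12)[OF assms(13)])
  have "(\<Sum>\<^sub>\<infinity>k\<in>T. ?K k * pmf (compound (Q \<nu>) F) k)
          = (\<Sum>\<^sub>\<infinity>k. ?K k * pmf (compound (Q \<nu>) F) k)"
    by (rule infsum_cong_neutral) (auto simp: T[OF assms(13), symmetric] set_pmf_iff)
  also have "\<dots> = deriv_in I A \<nu> / A \<nu>"
    using infsumI[OF has_sum_cond_exp_given_sum[OF assms(5) G_summable]]
    by (simp add: supp[OF assms(13)] mean_G)
  finally have mean_K: "(\<Sum>\<^sub>\<infinity>k\<in>T. ?K k * pmf (compound (Q \<nu>) F) k) = deriv_in I A \<nu> / A \<nu>" .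

  \<comment> \<open>The factorisation of the mass function through \<open>w\<close> and \<open>A\<close> is known on \<open>I\<close> only, and \<open>\<nu>\<close> may be
    an endpoint of \<open>I\<close>, so every derivative is taken within \<open>I\<close>.\<close>
  have score: "((\<lambda>\<mu>. ln (pmf (compound (Q \<mu>) F) k)) has_real_derivative
                  ?K k - deriv_in I A \<nu> / A \<nu>) (at \<nu> within I)" if "k \<in> T" for k
  proof -
    let ?W = "\<lambda>\<mu>. \<Sum>n\<in>S \<inter> {..k}. w n \<mu> * ?c n k"
    let ?W' = "\<Sum>n\<in>S \<inter> {..k}. ?w' n * ?c n k"
    have mass: "pmf (compound (Q \<mu>) F) k = ?W \<mu> / A \<mu>" if "\<mu> \<in> I" for \<mu>
      by (simp add: pmf_compound infsum_mult_conv_power[OF assms(5)] supp[OF that] sum_divide_distrib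
          assms(6)[OF _ that])
    have W_pos: "?W \<mu> > 0" if "\<mu> \<in> I" for \<mu>
    proof -
      have "pmf (compound (Q \<mu>) F) k > 0"
        using \<open>k \<in> T\<close> T[OF that] by (simp add: pmf_positive)
      then show ?thesis
        using mass[OF that] A_pos[OF that] by (simp add: zero_less_divide_iff)
    qed
    have "?K k * (?W \<nu> / A \<nu>) = (\<Sum>n\<in>S \<inter> {..k}. ?G n * pmf (Q \<nu>) n * ?c n k)"
      using cond_exp_given_sum_times_pmf[OF assms(5), of "Q \<nu>" ?G k]
      by (simp add: supp[OF assms(13)] mass[OF assms(13)])
    also have "\<dots> = ?W' / A \<nu>"
      by (simp add: G sum_divide_distrib)
    finally have K: "?K k = ?W' / ?W \<nu>"
      using W_pos[OF assms(13)] A_pos[OF assms(13)] by (simp add: field_simps)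
    have dW: "(?W has_real_derivative ?W') (at \<nu> within I)"
      by (intro DERIV_sum DERIV_cmult_right dw) auto
    have "((\<lambda>\<mu>. ln (?W \<mu>)) has_real_derivative ?W' / ?W \<nu>) (at \<nu> within I)"
      by (rule has_real_derivative_ln_within[OF dW W_pos[OF assms(13)]])
    moreover have "((\<lambda>\<mu>. ln (A \<mu>)) has_real_derivative deriv_in I A \<nu> / A \<nu>) (at \<nu> within I)"
      by (rule has_real_derivative_ln_within[OF dA A_pos[OF assms(13)]])
    ultimately have "((\<lambda>\<mu>. ln (?W \<mu>) - ln (A \<mu>)) has_real_derivative
                  ?K k - deriv_in I A \<nu> / A \<nu>) (at \<nu> within I)"
      unfolding K by (rule DERIV_diff)
    then show ?thesis
    proof (rule has_field_derivative_transform_within[OF _ zero_less_one assms(13)])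
      fix \<mu> assume \<mu>: "\<mu> \<in> I"
      show "ln (?W \<mu>) - ln (A \<mu>) = ln (pmf (compound (Q \<mu>) F) k)"
        by (simp add: mass[OF \<mu>] ln_divide_pos[OF W_pos[OF \<mu>] A_pos[OF \<mu>]])
    qed
  qed

  show ?thesis
    unfolding is_kernel_def
  proof (intro exI[of _ T] conjI ballI)
    show "common_support I (\<lambda>\<mu>. compound (Q \<mu>) F) T"
      by (simp add: common_support_def T)
    show "integrable (measure_pmf (compound (Q \<nu>) F)) ?K"
      by (rule integrable_cond_exp_given_sum[OF assms(5) G_summable])
  next
    fix k assume k: "k \<in> T"
    show "(\<lambda>\<mu>. ln (pmf (compound (Q \<mu>) F) k)) differentiable (at \<nu> within I)"
      using score[OF k] by (auto simp: real_differentiable_def)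
    show "score I (\<lambda>\<mu>. compound (Q \<mu>) F) \<nu> k
            = ?K k - (\<Sum>\<^sub>\<infinity>j\<in>T. ?K j * pmf (compound (Q \<nu>) F) j)"
      unfolding score_def mean_K by (rule deriv_in_eqI[OF nontrivial score[OF k]])
  qed
qed

end
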